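(* Let $G$ be a matrix weighted connected graph of order $n$ in which each weight matrix is positive definite of order $k$, and let $L=L(G)$ and $R=R(G)$. Put $\tau_i=2I_k+\sum_{j\in V(G)}L_{ij}R_{ij}$ for $i=1,\dots,n$, and let $\tau=(\tau_1,\tau_2,\dots,\tau_n)^T$ be the $nk\times k$ block column with blocks $\tau_1,\dots,\tau_n$. Then $$(\mathbf{1}^T\otimes I_k)\,\tau=2I_k.$$
   Context: A matrix weighted graph is a finite, simple, undirected, connected graph in which each edge $ij$ is assigned a weight $W_{ij}=W_{ji}$ that is a (real symmetric) positive definite matrix of a given order $k$. For a matrix weighted graph $G$ with vertices $1,\dots,n$, the Laplacian $L=L(G)$ is the $nk\times nk$ block matrix with $k\times k$ blocks $L_{ii}=\sum_{j\sim i}W_{ij}^{-1}$, $L_{ij}=-W_{ij}^{-1}$ if $i\neq j$ and $i\sim j$, and $L_{ij}=0$ if $i\ne j$ and $i\nsim j$. A $(1)$-inverse of a matrix $M$ is a matrix $C$ with $MCM=M$. The resistance matrix $R=R(G)$ is the $nk\times nk$ block matrix with blocks $R_{ij}=L^{(1)}_{ii}+L^{(1)}_{jj}-L^{(1)}_{ij}-L^{(1)}_{ji}$, where $L^{(1)}$ is any $(1)$-inverse of $L$ (the result does not depend on the choice). $\mathbf{1}$ is the all-ones column vector of length $n$, $I_k$ is the identity matrix of order $k$, and $\otimes$ is the Kronecker product. *)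

theory Defs
  imports "Graph_Theory.Graph_Theory" "HOL-Analysis.Analysis"
begin

text \<open>
  Vertices are the elements of a finite type \<open>'n\<close> (so \<open>n = CARD('n)\<close>) and the order of the
  weights is \<open>k = CARD('k)\<close>.  Block matrices with \<open>k \<times> k\<close> blocks are indexed by pairs
  (block index, index inside the block).
\<close>

definition block_mat :: "('m \<Rightarrow> 'n \<Rightarrow> real^'k^'k) \<Rightarrow> real^('n::finite \<times> 'k::finite)^('m::finite \<times> 'k)"
  where "block_mat B = (\<chi> p q. B (fst p) (fst q) $ snd p $ snd q)"

definition block :: "real^('n::finite \<times> 'k::finite)^('m::finite \<times> 'k) \<Rightarrow> 'm \<Rightarrow> 'n \<Rightarrow> real^'k^'k"
  where "block M i j = (\<chi> a b. M $ (i, a) $ (j, b))"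

definition kronecker ::
    "real^'n^'m \<Rightarrow> real^'q^'p \<Rightarrow> real^('n::finite \<times> 'q::finite)^('m::finite \<times> 'p::finite)"
    (infixl \<open>\<otimes>\<^sub>K\<close> 75)
  where "A \<otimes>\<^sub>K B = (\<chi> p q. A $ fst p $ fst q * B $ snd p $ snd q)"

definition all_ones :: "real^1^'n::finite"
  where "all_ones = (\<chi> i j. 1)"

definition positive_definite :: "real^'k^'k::finite \<Rightarrow> bool"
  where "positive_definite A \<longleftrightarrow> transpose A = A \<and> (\<forall>x. x \<noteq> 0 \<longrightarrow> x \<bullet> (A *v x) > 0)"

text \<open>
  The locale \<open>graph\<close> describes finite simple undirected graphs as loop-free symmetric digraphs
  without parallel arcs; \<open>connected\<close> has to be qualified to distinguish it from the topological
  notion.  The values of \<open>W\<close> outside the edges are irrelevant.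
\<close>

locale matrix_weighted_graph = graph G
  for G :: "('n::finite, 'e) pre_digraph" +
  fixes W :: "'n \<Rightarrow> 'n \<Rightarrow> real^'k::finite^'k"
  assumes verts_UNIV: "verts G = UNIV"
    and connected: "Digraph_Component.connected G"
    and weight_sym: "i \<rightarrow>\<^bsub>G\<^esub> j \<Longrightarrow> W i j = W j i"
    and weight_pos_def: "i \<rightarrow>\<^bsub>G\<^esub> j \<Longrightarrow> positive_definite (W i j)"

definition laplacian ::
    "('n::finite, 'e) pre_digraph \<Rightarrow> ('n \<Rightarrow> 'n \<Rightarrow> real^'k::finite^'k) \<Rightarrow> real^('n \<times> 'k)^('n \<times> 'k)"
  where "laplacian G W = block_mat (\<lambda>i j.
    if i = j then (\<Sum>l | i \<rightarrow>\<^bsub>G\<^esub> l. matrix_inv (W i l))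
    else if i \<rightarrow>\<^bsub>G\<^esub> j then - matrix_inv (W i j)
    else 0)"

definition one_inverse :: "real^'n::finite^'m::finite \<Rightarrow> real^'m^'n \<Rightarrow> bool"
  where "one_inverse M C \<longleftrightarrow> M ** C ** M = M"

text \<open>Every real matrix has a (1)-inverse, so the next predicate is never empty.\<close>

lemma one_inverse_exists: "\<exists>C. one_inverse M C"
proof -
  obtain g where g: "linear g" "\<forall>v\<in>range ((*v) M). M *v g v = v"
    using linear_exists_right_inverse_on[of "(*v) M" UNIV] by auto
  have "M ** matrix g ** M = M"
    unfolding matrix_eq
    using g by (simp add: matrix_vector_mul_assoc[symmetric] matrix_works)
  then show ?thesis
    unfolding one_inverse_def by blast
qed

text \<open>
  \<open>is_resistance_matrix G W R\<close> says that \<open>R\<close> is obtained from some (1)-inverse \<open>C\<close> of the Laplacian.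
  The matrix \<open>R\<close> is in fact independent of \<open>C\<close>; a statement about every \<open>R\<close> satisfying the
  predicate is a statement about every choice of \<open>C\<close>.
\<close>

definition is_resistance_matrix ::
    "('n::finite, 'e) pre_digraph \<Rightarrow> ('n \<Rightarrow> 'n \<Rightarrow> real^'k::finite^'k) \<Rightarrow>
      real^('n \<times> 'k)^('n \<times> 'k) \<Rightarrow> bool"
  where "is_resistance_matrix G W R \<longleftrightarrow> (\<exists>C. one_inverse (laplacian G W) C \<and>
    R = block_mat (\<lambda>i j. block C i i + block C j j - block C i j - block C j i))"

lemma is_resistance_matrix_exists: "\<exists>R. is_resistance_matrix G W R"
  using one_inverse_exists unfolding is_resistance_matrix_def by blast

definition tau_block ::
    "real^('n::finite \<times> 'k::finite)^('n \<times> 'k) \<Rightarrow> real^('n \<times> 'k)^('n \<times> 'k) \<Rightarrow> 'n \<Rightarrow> real^'k^'k"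
  where "tau_block L R i = 2 *\<^sub>R mat 1 + (\<Sum>j\<in>UNIV. block L i j ** block R i j)"

text \<open>A block column has a single block column, indexed by the one-element type \<open>1\<close>.  Likewise the
  \<open>k \<times> nk\<close> matrix \<open>transpose all_ones \<otimes>\<^sub>K mat 1\<close> has its rows indexed by \<open>1 \<times> 'k\<close>, so its product
  with \<open>tau L R\<close> is a \<open>k \<times> k\<close> matrix over the index type \<open>1 \<times> 'k\<close>.\<close>

definition tau ::
    "real^('n::finite \<times> 'k::finite)^('n \<times> 'k) \<Rightarrow> real^('n \<times> 'k)^('n \<times> 'k) \<Rightarrow>
      real^(1 \<times> 'k)^('n \<times> 'k)"
  where "tau L R = block_mat (\<lambda>i _. tau_block L R i)"

end

theory Submission
  imports Defs
begin

text \<open>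
  The block rows and block columns of \<open>L\<close> sum to zero, so in \<open>\<Sum>\<^sub>i \<tau>\<^sub>i\<close> the diagonal blocks of the
  (1)-inverse \<open>C\<close> cancel, and by the symmetry of \<open>L\<close> and of its blocks what remains is
  \<open>2 n I - 2 \<Sum>\<^sub>i (L C)\<^sub>i\<^sub>i\<close>.  From \<open>(L C - I) L = 0\<close> the rows of \<open>L C - I\<close> lie in the kernel of \<open>L\<close>,
  which by connectedness consists of the vectors \<open>\<one> \<otimes> x\<close>.  Hence block \<open>(i, j)\<close> of \<open>L C - I\<close> does not
  depend on \<open>j\<close>, and the sum of its diagonal blocks is the sum of any of its block columns, which
  is \<open>- I\<close> because the block columns of \<open>L C\<close> sum to zero.  So \<open>\<Sum>\<^sub>i (L C)\<^sub>i\<^sub>i = (n - 1) I\<close>.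
\<close>

lemma sum_matrix_mult_left: "(\<Sum>j\<in>S. A j) ** B = (\<Sum>j\<in>S. A j ** (B :: real^'p^'n))"
  by (simp add: vec_eq_iff matrix_matrix_mult_def sum_distrib_right) (intro allI sum.swap)

lemma sum_matrix_vector_mult_left: "(\<Sum>j\<in>S. A j) *v x = (\<Sum>j\<in>S. A j *v (x :: real^'n))"
  by (induction S rule: infinite_finite_induct) (auto simp: matrix_vector_mult_add_rdistrib)

lemma matrix_mult_diff_rdistrib: "(A - B) ** C = A ** C - B ** (C :: real^'p^'n)"
  by (vector matrix_matrix_mult_def sum_subtractf left_diff_distrib)

lemma matrix_mult_diff_ldistrib: "C ** (A - B) = C ** A - C ** (B :: real^'p^'n)"
  by (vector matrix_matrix_mult_def sum_subtractf right_diff_distrib)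

lemma transpose_sum: "transpose (\<Sum>j\<in>S. A j) = (\<Sum>j\<in>S. transpose (A j :: real^'p^'q))"
  by (simp add: transpose_def vec_eq_iff)

lemma transpose_diff: "transpose (A - B) = transpose A - transpose (B :: real^'p^'q)"
  by (simp add: transpose_def vec_eq_iff)

lemma transpose_zero: "transpose 0 = (0 :: real^'p^'q)"
  by (simp add: transpose_def vec_eq_iff)

lemma block_block_mat [simp]: "block (block_mat B) i j = B i j"
  by (simp add: block_def block_mat_def vec_eq_iff)

lemma block_diff: "block (A - B) i j = block A i j - block B i j"
  by (simp add: block_def vec_eq_iff)

lemma block_mat_1: "block (mat 1) i j = (if i = j then mat 1 else 0)"
  by (simp add: block_def mat_def vec_eq_iff)

lemma block_mult:
  fixes A :: "real^('l::finite \<times> 'k::finite)^('m::finite \<times> 'k)"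
    and B :: "real^('n::finite \<times> 'k)^('l \<times> 'k)"
  shows "block (A ** B) i j = (\<Sum>l\<in>UNIV. block A i l ** block B l j)"
  by (simp add: vec_eq_iff block_def matrix_matrix_mult_def sum.cartesian_product)

definition vec_block :: "real^('n::finite \<times> 'k::finite) \<Rightarrow> 'n \<Rightarrow> real^'k"
  where "vec_block x i = (\<chi> a. x $ (i, a))"

lemma vec_block_mult:
  fixes A :: "real^('n::finite \<times> 'k::finite)^('m::finite \<times> 'k)"
  shows "vec_block (A *v x) i = (\<Sum>j\<in>UNIV. block A i j *v vec_block x j)"
  by (simp add: vec_eq_iff block_def vec_block_def matrix_vector_mult_def sum.cartesian_product)

lemma ones_kronecker_mult_block_column:
  fixes T :: "'n::finite \<Rightarrow> real^'k::finite^'k"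
  shows "(transpose (all_ones :: real^1^'n) \<otimes>\<^sub>K (mat 1 :: real^'k^'k)) ** block_mat (\<lambda>i _. T i)
           = (block_mat (\<lambda>_ _. \<Sum>i\<in>UNIV. T i) :: real^(1 \<times> 'k)^(1 \<times> 'k))"
proof -
  have "block (transpose (all_ones :: real^1^'n) \<otimes>\<^sub>K (mat 1 :: real^'k^'k)) u i = mat 1" for u i
    by (simp add: vec_eq_iff block_def kronecker_def all_ones_def transpose_def)
  then have "block ((transpose (all_ones :: real^1^'n) \<otimes>\<^sub>K (mat 1 :: real^'k^'k)) **
      (block_mat (\<lambda>i _. T i) :: real^(1 \<times> 'k)^('n \<times> 'k))) u v = (\<Sum>i\<in>UNIV. T i)" for u v
    by (simp add: block_mult)
  then show ?thesis
    by (simp add: vec_eq_iff block_def block_mat_def split_paired_all)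
qed

text \<open>The substitution x = A y turns the quadratic form of the inverse at x into that of A at
  y. Symmetry holds because the transposed inverse is a left inverse of A.\<close>

lemma positive_definite_inverse:
  fixes A :: "real^'k::finite^'k"
  assumes "positive_definite A"
  shows "positive_definite (matrix_inv A)"
proof -
  have "\<forall>x. A *v x = 0 \<longrightarrow> x = 0"
    using assms unfolding positive_definite_def by (metis inner_zero_right less_irrefl)
  then have "invertible A"
    by (simp add: invertible_left_inverse matrix_left_invertible_ker)
  then have inv: "A ** matrix_inv A = mat 1" "matrix_inv A ** A = mat 1"
    unfolding invertible_def matrix_inv_def by (metis (mono_tags, lifting) someI_ex)+
  have "transpose (matrix_inv A) ** A = mat 1"
    using inv(1) assms unfolding positive_definite_def
    by (metis matrix_transpose_mul transpose_mat)
  then have "transpose (matrix_inv A) = matrix_inv A"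
    using inv(1) by (metis matrix_mul_assoc matrix_mul_lid matrix_mul_rid)
  moreover have "x \<bullet> (matrix_inv A *v x) > 0" if "x \<noteq> 0" for x
  proof -
    define y where "y = matrix_inv A *v x"
    have x: "x = A *v y"
      by (simp add: y_def matrix_vector_mul_assoc inv)
    with that have "y \<noteq> 0" by auto
    then have "y \<bullet> (A *v y) > 0"
      using assms by (simp add: positive_definite_def)
    then show ?thesis
      by (simp add: x[symmetric] y_def[symmetric] inner_commute)
  qed
  ultimately show ?thesis
    by (simp add: positive_definite_def)
qed

text \<open>Extending the inverse weights by zero to non-adjacent pairs lets all sums run over the
  whole vertex type.\<close>

definition conductance ::
    "('n::finite, 'e) pre_digraph \<Rightarrow> ('n \<Rightarrow> 'n \<Rightarrow> real^'k::finite^'k) \<Rightarrow> 'n \<Rightarrow> 'n \<Rightarrow> real^'k^'k"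
  where "conductance G W i j = (if i \<rightarrow>\<^bsub>G\<^esub> j then matrix_inv (W i j) else 0)"

context matrix_weighted_graph
begin

lemma conductance_sym: "conductance G W i j = conductance G W j i"
  using weight_sym arcs_ends_symmetric[OF sym_arcs]
  by (auto simp: conductance_def)

lemma transpose_conductance: "transpose (conductance G W i j) = conductance G W i j"
  using positive_definite_inverse[OF weight_pos_def]
  by (auto simp: conductance_def positive_definite_def transpose_def zero_vec_def)

lemma conductance_nonneg: "x \<bullet> (conductance G W i j *v x) \<ge> 0"
  using positive_definite_inverse[OF weight_pos_def]
  by (cases "x = 0") (auto simp: conductance_def positive_definite_def less_imp_le)

lemma conductance_pos:
  assumes "i \<rightarrow>\<^bsub>G\<^esub> j" "x \<noteq> 0"
  shows "x \<bullet> (conductance G W i j *v x) > 0"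
  using positive_definite_inverse[OF weight_pos_def] assms
  by (auto simp: conductance_def positive_definite_def)

text \<open>Degree minus adjacency: as there are no loops, the subtracted conductance vanishes on
  the diagonal.\<close>

lemma block_laplacian:
  "block (laplacian G W) i j
    = (if i = j then \<Sum>l\<in>UNIV. conductance G W i l else 0) - conductance G W i j"
proof -
  have "\<not> i \<rightarrow>\<^bsub>G\<^esub> i" for i
    using adj_not_same by auto
  then show ?thesis
    by (auto simp: laplacian_def conductance_def sum.If_cases)
qed

text \<open>Stronger than symmetry of the whole matrix, which would exchange the blocks only up to
  transposition. The column sums and the cross terms with \<open>block C i j\<close> rely on this
  form.\<close>

lemma block_laplacian_sym: "block (laplacian G W) i j = block (laplacian G W) j i"
  using conductance_sym[of i j] by (simp add: block_laplacian)

lemma transpose_block_laplacian: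
  "transpose (block (laplacian G W) i j) = block (laplacian G W) i j"
  by (simp add: block_laplacian transpose_diff transpose_zero transpose_sum transpose_conductance)

lemma transpose_laplacian: "transpose (laplacian G W) = laplacian G W"
proof -
  have "laplacian G W $ (j, b) $ (i, a) = laplacian G W $ (i, a) $ (j, b)" for i j a b
  proof -
    have "laplacian G W $ (j, b) $ (i, a) = transpose (block (laplacian G W) i j) $ a $ b"
      using block_laplacian_sym[of i j] by (simp add: block_def transpose_def)
    then show ?thesis
      by (simp only: transpose_block_laplacian) (simp add: block_def)
  qed
  then show ?thesis
    by (simp add: vec_eq_iff transpose_def split_paired_all)
qed

lemma laplacian_block_row_sum: "(\<Sum>j\<in>UNIV. block (laplacian G W) i j) = 0"
  by (simp add: block_laplacian sum_subtractf)

lemma laplacian_block_column_sum: "(\<Sum>i\<in>UNIV. block (laplacian G W) i j) = 0"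
  using laplacian_block_row_sum[of j] by (simp add: block_laplacian_sym[of _ j])

text \<open>An energy argument: the energy of a kernel vector is zero, so its blocks agree along
  each edge, and connectedness spreads the agreement to all vertices.\<close>

lemma laplacian_kernel:
  assumes "laplacian G W *v x = 0"
  shows "vec_block x i = vec_block x j"
proof -
  let ?N = "conductance G W" and ?y = "vec_block x"
  \<comment> \<open>The energy of \<open>x\<close>, with each edge counted in both directions.
    Splitting the left factor gives two double sums, and each of them vanishes.\<close>
  define E where "E = (\<Sum>i\<in>UNIV. \<Sum>l\<in>UNIV. (?y i - ?y l) \<bullet> (?N i l *v (?y i - ?y l)))"
  have "(\<Sum>l\<in>UNIV. ?N i l *v (?y i - ?y l)) = vec_block (laplacian G W *v x) i" for i
    unfolding vec_block_mult
    by (simp add: block_laplacian matrix_vector_mult_diff_distrib matrix_vector_mult_diff_rdistrib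
        sum_subtractf if_distrib[of "\<lambda>M. M *v _"] sum_matrix_vector_mult_left cong: if_cong)
  then have zero: "(\<Sum>l\<in>UNIV. ?N i l *v (?y i - ?y l)) = 0" for i
    by (simp add: assms vec_block_def vec_eq_iff)
  have first: "(\<Sum>i\<in>UNIV. \<Sum>l\<in>UNIV. ?y i \<bullet> (?N i l *v (?y i - ?y l))) = 0"
    by (simp flip: inner_sum_right add: zero)
  \<comment> \<open>Exchanging the names of the two endpoints keeps the conductance and flips the
    sign of the difference, so this is the negative of the first double sum.\<close>
  have "(\<Sum>i\<in>UNIV. \<Sum>l\<in>UNIV. ?y l \<bullet> (?N i l *v (?y i - ?y l)))
      = (\<Sum>l\<in>UNIV. \<Sum>i\<in>UNIV. - (?y l \<bullet> (?N l i *v (?y l - ?y i))))"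
    by (subst sum.swap, intro sum.cong refl, subst conductance_sym)
      (simp add: matrix_vector_mult_diff_distrib inner_diff_right)
  also have "\<dots> = 0"
    using first by (simp add: sum_negf)
  finally have "E = 0"
    using first by (simp add: E_def inner_diff_left sum_subtractf)
  then have terms: "(?y i - ?y l) \<bullet> (?N i l *v (?y i - ?y l)) = 0" for i l
    unfolding E_def
    by (simp add: sum_nonneg_eq_0_iff sum_nonneg conductance_nonneg)
  have adj: "?y i = ?y l" if "i \<rightarrow>\<^bsub>G\<^esub> l" for i l
    using terms[of i l] conductance_pos[OF that, of "?y i - ?y l"] by force
  \<comment> \<open>Arcs come in opposite pairs, so a directed path joins any two vertices and
    induction along it applies.\<close>
  have "strongly_connected G"
    using symmetric_connected_imp_strongly_connected[OF sym_arcs connected] .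
  then have "i \<rightarrow>\<^sup>*\<^bsub>G\<^esub> j"
    by (auto simp: verts_UNIV)
  then show ?thesis
    by (induction rule: reachable_induct) (auto dest: adj)
qed

lemma sum_diagonal_blocks_laplacian_mult_one_inverse:
  assumes "one_inverse (laplacian G W) C"
  shows "(\<Sum>i\<in>UNIV. block (laplacian G W ** C) i i) = (real CARD('n) - 1) *\<^sub>R mat 1"
proof -
  define D where "D = laplacian G W ** C - mat 1"
  \<comment> \<open>Symmetry of the Laplacian turns the left annihilation D L = 0 into a kernel
    statement about the rows of \<open>D\<close>.\<close>
  have "laplacian G W ** transpose D = transpose (D ** laplacian G W)"
    by (simp add: matrix_transpose_mul transpose_laplacian)
  also have "D ** laplacian G W = 0"
    using assms by (simp add: D_def one_inverse_def matrix_mult_diff_rdistrib)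
  finally have "laplacian G W ** transpose D = 0"
    by (simp add: transpose_zero)
  then have "laplacian G W *v D $ p = 0" for p
    by (cases p) (simp add: vec_eq_iff matrix_matrix_mult_def matrix_vector_mult_def transpose_def)
  then have "vec_block (D $ p) j = vec_block (D $ p) j'" for p j j'
    by (rule laplacian_kernel)
  then have row: "block D i j = block D i j'" for i j j'
    by (simp add: vec_eq_iff vec_block_def block_def)
  \<comment> \<open>Within each block row the diagonal block may be replaced by the one in a fixed
    column \<open>j\<close>.\<close>
  have "(\<Sum>i\<in>UNIV. block D i i) = (\<Sum>i\<in>UNIV. block D i j)" for j
    by (intro sum.cong refl row)
  moreover have "(\<Sum>i\<in>UNIV. block D i j) = - mat 1" for j
  proof -
    have "(\<Sum>i\<in>UNIV. block (laplacian G W ** C) i j)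
        = (\<Sum>l\<in>UNIV. (\<Sum>i\<in>UNIV. block (laplacian G W) i l) ** block C l j)"
      unfolding block_mult sum_matrix_mult_left by (rule sum.swap)
    also have "\<dots> = 0"
      by (simp add: laplacian_block_column_sum)
    finally show ?thesis
      by (simp add: D_def block_diff block_mat_1 sum_subtractf)
  qed
  ultimately have "(\<Sum>i\<in>UNIV. block D i i) = - mat 1"
    by simp
  \<comment> \<open>Adding back the n identity blocks on the diagonal of \<open>mat 1\<close> gives
    n - 1.\<close>
  then show ?thesis
    by (simp add: D_def block_diff block_mat_1 sum_subtractf scaleR_left_diff_distrib
        sum_constant_scaleR algebra_simps del: sum_constant)
qed

lemma sum_tau_block:
  assumes "is_resistance_matrix G W R"
  shows "(\<Sum>i\<in>UNIV. tau_block (laplacian G W) R i) = 2 *\<^sub>R mat 1"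
proof -
  let ?L = "block (laplacian G W)"
  obtain C where C: "one_inverse (laplacian G W) C"
    and R: "R = block_mat (\<lambda>i j. block C i i + block C j j - block C i j - block C j i)"
    using assms by (auto simp: is_resistance_matrix_def)
  let ?T = "\<Sum>i\<in>UNIV. block (laplacian G W ** C) i i"
  \<comment> \<open>The four terms of \<open>block R i j\<close> are summed separately. A diagonal
    block of \<open>C\<close> depends on one index only, so it factors out of a block row or block
    column sum.\<close>
  have "(\<Sum>i\<in>UNIV. \<Sum>j\<in>UNIV. ?L i j ** block C i i) = 0"
    by (simp add: laplacian_block_row_sum flip: sum_matrix_mult_left)
  moreover have "(\<Sum>i\<in>UNIV. \<Sum>j\<in>UNIV. ?L i j ** block C j j) = 0"
    by (subst sum.swap) (simp add: laplacian_block_column_sum flip: sum_matrix_mult_left)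
  moreover have T: "(\<Sum>i\<in>UNIV. \<Sum>j\<in>UNIV. ?L i j ** block C j i) = ?T"
    by (simp add: block_mult)
  moreover have "(\<Sum>i\<in>UNIV. \<Sum>j\<in>UNIV. ?L i j ** block C i j) = ?T"
    by (subst sum.swap, subst block_laplacian_sym) (rule T)
  ultimately have "(\<Sum>i\<in>UNIV. \<Sum>j\<in>UNIV. ?L i j ** block R i j) = - (2 *\<^sub>R ?T)"
    by (simp add: R matrix_mult_diff_ldistrib matrix_add_ldistrib sum_subtractf sum.distrib
        scaleR_2)
  \<comment> \<open>The n summands 2I meet -2(n - 1)I, which leaves 2I.\<close>
  then show ?thesis
    by (simp add: tau_block_def sum.distrib sum_constant_scaleR
        sum_diagonal_blocks_laplacian_mult_one_inverse[OF C] algebra_simps del: sum_constant)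
qed

end

theorem theorem3p6:
  fixes G :: "('n::finite, 'e) pre_digraph"
    and W :: "'n \<Rightarrow> 'n \<Rightarrow> real^'k::finite^'k"
    and R :: "real^('n \<times> 'k)^('n \<times> 'k)"
  assumes "matrix_weighted_graph G W"
    and "is_resistance_matrix G W R"
  shows "(transpose (all_ones :: real^1^'n) \<otimes>\<^sub>K (mat 1 :: real^'k^'k)) ** tau (laplacian G W) R
           = 2 *\<^sub>R (mat 1 :: real^(1 \<times> 'k)^(1 \<times> 'k))"
proof -
  have "(transpose (all_ones :: real^1^'n) \<otimes>\<^sub>K (mat 1 :: real^'k^'k)) ** tau (laplacian G W) R
      = block_mat (\<lambda>_ _. 2 *\<^sub>R mat 1)"
    using assms
    by (simp add: tau_def ones_kronecker_mult_block_column matrix_weighted_graph.sum_tau_block)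
  also have "\<dots> = 2 *\<^sub>R mat 1"
    by (simp add: vec_eq_iff block_mat_def mat_def prod_eq_iff)
  finally show ?thesis .
qed

end
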